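(* It can be decided in polynomial time whether the arc set of a given loop-free digraph $D$ can be partitioned into an in-branching and an acyclic subgraph. Such a partition exists if and only if there exists no nonempty induced subgraph of $D$ in which the outdegree of each vertex is at least $2$.
   Context: Digraphs are finite and loop-free; parallel arcs are allowed (and counted with multiplicity in degrees). An in-branching of $D=(V,A)$ is a set of arcs $B\subseteq A$ containing no directed cycle and such that every vertex has at most one outgoing arc in $B$ (i.e., a forest of in-trees directed towards their roots; the number of roots is arbitrary). A subgraph is acyclic if it contains no directed cycle. Either part of the partition may be empty. *)

theory Defs
  imports
    "Graph_Theory.Digraph_Component"
    "HOL-Computational_Algebra.Polynomial"
begin

section \<open>In-branchings and acyclic arc sets\<close>

text \<open>
  Digraphs are those of the AFP entry Graph_Theory.  Arcs are objects of their own, so parallel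
  arcs are possible and the out-degree counts them with multiplicity.  A cycle is a nonempty closed
  directed walk, given by its list of arcs, whose vertices are distinct except for its two ends.
\<close>

definition acyclic_arcs :: "('a, 'b) pre_digraph \<Rightarrow> 'b set \<Rightarrow> bool" where
  "acyclic_arcs D X \<longleftrightarrow> X \<subseteq> arcs D \<and> \<not> (\<exists>p. pre_digraph.cycle D p \<and> set p \<subseteq> X)"

definition in_branching :: "('a, 'b) pre_digraph \<Rightarrow> 'b set \<Rightarrow> bool" where
  "in_branching D B \<longleftrightarrow> acyclic_arcs D B \<and>
     (\<forall>e\<in>B. \<forall>e'\<in>B. tail D e = tail D e' \<longrightarrow> e = e')"

definition has_branching_acyclic_partition :: "('a, 'b) pre_digraph \<Rightarrow> bool" where
  "has_branching_acyclic_partition D \<longleftrightarrow>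
     (\<exists>B C. B \<union> C = arcs D \<and> B \<inter> C = {} \<and> in_branching D B \<and> acyclic_arcs D C)"


section \<open>Polynomial time\<close>

text \<open>
  Deterministic Turing machines with finitely many two-way infinite tapes.  States are the
  numbers below \<open>tm_states\<close>, tape symbols the numbers below \<open>tm_symbols\<close>; symbol 0 is the blank,
  and 1 and 2 represent the input bits False and True.  Only the values of \<open>tm_delta\<close> on such states
  and on lists of \<open>tm_tapes\<close> such symbols matter, so a machine is a finite object.
\<close>

datatype direction = Left | Stay | Right

record tm =
  tm_tapes :: nat
  tm_symbols :: nat
  tm_states :: nat
  tm_start :: nat
  tm_accept :: nat
  tm_reject :: nat
  tm_delta :: "nat \<Rightarrow> nat list \<Rightarrow> nat \<times> (nat \<times> direction) list"

definition tm_wf :: "tm \<Rightarrow> bool" where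
  "tm_wf M \<longleftrightarrow>
     1 \<le> tm_tapes M \<and> 3 \<le> tm_symbols M \<and>
     tm_start M < tm_states M \<and> tm_accept M < tm_states M \<and> tm_reject M < tm_states M \<and>
     tm_accept M \<noteq> tm_reject M \<and>
     (\<forall>q < tm_states M. \<forall>xs. length xs = tm_tapes M \<and> (\<forall>x \<in> set xs. x < tm_symbols M) \<longrightarrow>
        (case tm_delta M q xs of (q', as) \<Rightarrow>
           q' < tm_states M \<and> length as = tm_tapes M \<and> (\<forall>(y, d) \<in> set as. y < tm_symbols M)))"

text \<open>A tape consists of its cell contents and the position of the head.\<close>

type_synonym tape = "(int \<Rightarrow> nat) \<times> int"

type_synonym config = "nat \<times> tape list"

definition tape_read :: "tape \<Rightarrow> nat" where
  "tape_read t = fst t (snd t)"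

definition tape_act :: "nat \<times> direction \<Rightarrow> tape \<Rightarrow> tape" where
  "tape_act a t =
     ((fst t)(snd t := fst a),
      (case snd a of Left \<Rightarrow> snd t - 1 | Stay \<Rightarrow> snd t | Right \<Rightarrow> snd t + 1))"

definition tm_step :: "tm \<Rightarrow> config \<Rightarrow> config" where
  "tm_step M c =
     (if fst c = tm_accept M \<or> fst c = tm_reject M then c
      else (case tm_delta M (fst c) (map tape_read (snd c)) of (q', as) \<Rightarrow>
              (q', map2 tape_act as (snd c))))"

definition blank_tape :: tape where
  "blank_tape = (\<lambda>_. 0, 0)"

definition input_tape :: "bool list \<Rightarrow> tape" where
  "input_tape w =
     (\<lambda>i. if 0 \<le> i \<and> i < int (length w) then (if w ! nat i then 2 else 1) else 0, 0)"

definition tm_init :: "tm \<Rightarrow> bool list \<Rightarrow> config" where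
  "tm_init M w = (tm_start M, input_tape w # replicate (tm_tapes M - 1) blank_tape)"

text \<open>
  Since accepting and rejecting configurations are fixed points of \<open>tm_step\<close>, being in the right
  final state after exactly \<open>poly p (length w)\<close> steps means having halted there within that many
  steps.
\<close>

definition poly_time_decidable :: "bool list set \<Rightarrow> bool" where
  "poly_time_decidable L \<longleftrightarrow>
     (\<exists>M. \<exists>p :: nat poly. tm_wf M \<and>
        (\<forall>w. fst ((tm_step M ^^ poly p (length w)) (tm_init M w)) =
              (if w \<in> L then tm_accept M else tm_reject M)))"


section \<open>Digraphs as inputs\<close>

text \<open>
  Every finite digraph is isomorphic to one with vertices \<open>0, \<dots>, n - 1\<close> that is given by \<open>n\<close> and
  the list of the (tail, head) pairs of its arcs; repeated entries are parallel arcs.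
\<close>

definition list_digraph :: "nat \<Rightarrow> (nat \<times> nat) list \<Rightarrow> (nat, nat) pre_digraph" where
  "list_digraph n es =
     \<lparr>verts = {..<n}, arcs = {..<length es}, tail = (\<lambda>i. fst (es ! i)), head = (\<lambda>i. snd (es ! i))\<rparr>"

lemma list_digraph_wf_iff:
  "wf_digraph (list_digraph n es) \<longleftrightarrow> (\<forall>(u, v) \<in> set es. u < n \<and> v < n)"
proof -
  have "wf_digraph (list_digraph n es) \<longleftrightarrow> (\<forall>i < length es. fst (es ! i) < n \<and> snd (es ! i) < n)"
    by (auto simp: wf_digraph_def list_digraph_def)
  also have "\<dots> \<longleftrightarrow> (\<forall>(u, v) \<in> set es. u < n \<and> v < n)"
    unfolding case_prod_beta all_set_conv_all_nth ..
  finally show ?thesis .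
qed

text \<open>
  Vertices are written in unary.  By \<open>length_digraph_code_le\<close> below, the code of a digraph still has
  length polynomial in the number of its vertices and arcs, so this does not affect the meaning of
  polynomial time.
\<close>

definition unary :: "nat \<Rightarrow> bool list" where
  "unary k = replicate k True @ [False]"

definition digraph_code :: "nat \<Rightarrow> (nat \<times> nat) list \<Rightarrow> bool list" where
  "digraph_code n es = unary n @ concat (map (\<lambda>(u, v). unary u @ unary v) es)"

lemma length_digraph_code_le:
  assumes "wf_digraph (list_digraph n es)"
  shows "length (digraph_code n es) \<le> (n + 1) + length es * (2 * n)"
proof -
  have "\<forall>(u, v) \<in> set es. u < n \<and> v < n"
    using assms by (simp add: list_digraph_wf_iff)
  hence "length (concat (map (\<lambda>(u, v). unary u @ unary v) es)) \<le> length es * (2 * n)"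
    by (induction es) (auto simp: unary_def)
  thus ?thesis
    by (simp add: digraph_code_def unary_def)
qed

lemma unary_append_inject: "unary a @ xs = unary b @ ys \<longleftrightarrow> a = b \<and> xs = ys"
proof (induction a arbitrary: b)
  case 0
  show ?case by (cases b) (auto simp: unary_def)
next
  case (Suc a)
  thus ?case by (cases b) (auto simp: unary_def)
qed

lemma digraph_code_inject: "digraph_code n es = digraph_code m fs \<longleftrightarrow> n = m \<and> es = fs"
proof -
  have "concat (map (\<lambda>(u, v). unary u @ unary v) es) = concat (map (\<lambda>(u, v). unary u @ unary v) fs)
          \<longleftrightarrow> es = fs"
  proof (induction es arbitrary: fs)
    case Nil
    show ?case by (cases fs) (auto simp: unary_def)
  next
    case (Cons e es)
    show ?case
    proof (cases fs)
      case Nil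
      thus ?thesis by (cases e) (auto simp: unary_def)
    next
      case (Cons f fs')
      thus ?thesis
        using Cons.IH[of fs'] by (cases e; cases f) (auto simp: unary_append_inject)
    qed
  qed
  thus ?thesis by (simp add: digraph_code_def unary_append_inject)
qed

definition branching_acyclic_partition_language :: "bool list set" where
  "branching_acyclic_partition_language =
     {digraph_code n es | n es.
        fin_digraph (list_digraph n es) \<and> loopfree_digraph (list_digraph n es) \<and>
        has_branching_acyclic_partition (list_digraph n es)}"

end

theory Submission
  imports Defs
begin

text \<open>
  A partition exists if and only if no nonempty vertex set \<open>S\<close> induces a subgraph with all
  out-degrees at least two.  If \<open>B\<close> and \<open>C\<close> form a partition and \<open>S\<close> is nonempty, then the
  arcs of \<open>C\<close> within \<open>S\<close> are acyclic, so some vertex of \<open>S\<close> has no arc of \<open>C\<close> into \<open>S\<close>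
  (\<open>acyclic_arcs_sink\<close>); all of its arcs into \<open>S\<close> belong to \<open>B\<close>, which contains at most one of
  them.  Conversely, if there is no such \<open>S\<close>, then the vertices can be removed one by one such that
  each has at most one arc to the vertices that remain (\<open>exists_peeling_rank\<close>).  The arcs that
  agree with this order form an in-branching, the others are acyclic, as there are no loops
  (\<open>branching_acyclic_partition_iff\<close>).

  The largest \<open>S\<close> as above is found by peeling: beginning with all vertices, the vertices with at
  most one arc into the present set are removed in rounds, and on \<open>n\<close> vertices this is stable
  after at most \<open>n\<close> rounds (\<open>funpow_eq_empty_iff\<close>).  So a partition exists if and only if
  no vertex is left after \<open>n + 1\<close> rounds (\<open>has_partition_list_digraph_iff\<close>).  The extra round makes the
  input be checked even for \<open>n = 0\<close>.

  A five-tape Turing machine carries out these rounds.  It uses head positions as counters: while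
  the unary code of a vertex is read, the head of an array tape moves along with it to the cell of
  that vertex.  One round is a single pass over the list of arcs, with the heads moved back
  after each arc, and so takes time linear in the length of the input (\<open>run_round\<close>); every round
  also checks the syntax of the input and rejects on failure (\<open>rejects_improper\<close>).  The whole
  computation is quadratic (\<open>peel_tm_decides\<close>).
\<close>

section \<open>Acyclic partitions and peeling\<close>

text \<open>
  The vertex sets \<open>S\<close> such that every vertex of the subgraph induced by \<open>S\<close> has out-degree at least
  two in it.  Arcs are counted, hence parallel arcs with multiplicity.
\<close>

definition two_out_closed :: "('a, 'b) pre_digraph \<Rightarrow> 'a set \<Rightarrow> bool" where
  "two_out_closed D S \<longleftrightarrow> (\<forall>v \<in> S. 2 \<le> card {e \<in> arcs D. tail D e = v \<and> head D e \<in> S})"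

lemma ex_induced_subgraph_iff_two_out_closed:
  assumes "wf_digraph D"
  shows "(\<exists>H. induced_subgraph H D \<and> verts H \<noteq> {} \<and> (\<forall>v \<in> verts H. 2 \<le> out_degree H v)) \<longleftrightarrow>
    (\<exists>S. S \<subseteq> verts D \<and> S \<noteq> {} \<and> two_out_closed D S)"
proof
  assume "\<exists>H. induced_subgraph H D \<and> verts H \<noteq> {} \<and> (\<forall>v \<in> verts H. 2 \<le> out_degree H v)"
  then obtain H where H: "induced_subgraph H D" "verts H \<noteq> {}" "\<forall>v \<in> verts H. 2 \<le> out_degree H v"
    by blast
  have "tail H = tail D" and "verts H \<subseteq> verts D"
    using H(1) by (auto simp: induced_subgraph_def subgraph_def compatible_def)
  hence "out_arcs H v = {e \<in> arcs D. tail D e = v \<and> head D e \<in> verts H}" if "v \<in> verts H" for v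
    using that H(1) by (auto simp: out_arcs_def induced_subgraph_def)
  hence "two_out_closed D (verts H)"
    using H(3) by (auto simp: two_out_closed_def out_degree_def)
  thus "\<exists>S. S \<subseteq> verts D \<and> S \<noteq> {} \<and> two_out_closed D S"
    using H(2) \<open>verts H \<subseteq> verts D\<close> by blast
next
  assume "\<exists>S. S \<subseteq> verts D \<and> S \<noteq> {} \<and> two_out_closed D S"
  then obtain S where S: "S \<subseteq> verts D" "S \<noteq> {}" "two_out_closed D S"
    by blast
  have "out_arcs (D \<restriction> S) v = {e \<in> arcs D. tail D e = v \<and> head D e \<in> S}" if "v \<in> S" for v
    using that by (auto simp: out_arcs_def)
  hence "\<forall>v \<in> S. 2 \<le> out_degree (D \<restriction> S) v"
    using S(3) by (simp add: two_out_closed_def out_degree_def)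
  moreover have "induced_subgraph (D \<restriction> S) D"
    using wf_digraph.induced_induce[OF assms] S(1) by blast
  ultimately show "\<exists>H. induced_subgraph H D \<and> verts H \<noteq> {} \<and> (\<forall>v \<in> verts H. 2 \<le> out_degree H v)"
    using S(2) by (intro exI[of _ "D \<restriction> S"]) simp
qed

lemma acyclic_arcs_if_increasing:
  fixes r :: "'a \<Rightarrow> nat"
  assumes "wf_digraph D" "X \<subseteq> arcs D" "\<And>e. e \<in> X \<Longrightarrow> r (tail D e) < r (head D e)"
  shows "acyclic_arcs D X"
proof -
  interpret wf_digraph D by fact
  have walk: "r u + length p \<le> r v" if "awalk u p v" "set p \<subseteq> X" for u p v
    using that
  proof (induction p arbitrary: u)
    case Nil
    thus ?case by (simp add: awalk_Nil_iff)
  next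
    case (Cons e p)
    have "r (head D e) + length p \<le> r v" and "r u < r (head D e)"
      using Cons assms(3)[of e] by (auto simp: awalk_Cons_iff)
    thus ?case by simp
  qed
  have False if "cycle p" "set p \<subseteq> X" for p
    using that walk by (force simp: cycle_def)
  thus ?thesis
    using assms(2) by (auto simp: acyclic_arcs_def)
qed

lemma acyclic_arcs_if_decreasing:
  fixes r :: "'a \<Rightarrow> nat"
  assumes "wf_digraph D" "X \<subseteq> arcs D" "\<And>e. e \<in> X \<Longrightarrow> r (head D e) < r (tail D e)"
  shows "acyclic_arcs D X"
proof -
  interpret wf_digraph D by fact
  have walk: "r v + length p \<le> r u" if "awalk u p v" "set p \<subseteq> X" for u p v
    using that
  proof (induction p arbitrary: u)
    case Nil
    thus ?case by (simp add: awalk_Nil_iff)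
  next
    case (Cons e p)
    have "r v + length p \<le> r (head D e)" and "r (head D e) < r u"
      using Cons assms(3)[of e] by (auto simp: awalk_Cons_iff)
    thus ?case by simp
  qed
  have False if "cycle p" "set p \<subseteq> X" for p
    using that walk by (force simp: cycle_def)
  thus ?thesis
    using assms(2) by (auto simp: acyclic_arcs_def)
qed

text \<open>
  Every closed walk contains a cycle; applied to the subgraph with arc set \<open>X\<close>, this turns the
  absence of cycles within \<open>X\<close> into the absence of closed walks within \<open>X\<close>.
\<close>

lemma acyclic_arcs_no_closed_walk:
  assumes "wf_digraph D" "acyclic_arcs D X" "pre_digraph.awalk D u p u" "set p \<subseteq> X"
  shows "p = []"
proof (rule ccontr)
  assume "p \<noteq> []"
  let ?D = "D\<lparr>arcs := X\<rparr>"
  interpret wf_digraph D by fact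
  have X: "X \<subseteq> arcs D"
    using assms(2) by (simp add: acyclic_arcs_def)
  interpret X: wf_digraph ?D
    using X by unfold_locales auto
  have cas: "X.cas x q y = cas x q y" for x q y
    by (induction q arbitrary: x) auto
  have verts: "X.awalk_verts x q = awalk_verts x q" for x q
    by (induction q arbitrary: x) auto
  have "X.awalk u p u"
    using assms(3,4) by (simp add: X.awalk_def awalk_def cas)
  hence "X.closed_w p"
    using \<open>p \<noteq> []\<close> by (auto simp: X.closed_w_def)
  then obtain q where "X.cycle q"
    using X.closed_w_imp_cycle by blast
  hence "cycle q" and "set q \<subseteq> X"
    using X by (auto simp: X.cycle_def cycle_def X.awalk_def awalk_def cas verts)
  thus False
    using assms(2) by (auto simp: acyclic_arcs_def)
qed

text \<open>
  If each vertex of \<open>S\<close> had an arc of \<open>X\<close> leading into \<open>S\<close>, following these arcs would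
  eventually revisit a vertex and yield a closed walk.
\<close>

lemma acyclic_arcs_sink:
  assumes "wf_digraph D" "acyclic_arcs D X" "finite S" "S \<noteq> {}" "S \<subseteq> verts D"
  shows "\<exists>v \<in> S. \<forall>e \<in> X. tail D e = v \<longrightarrow> head D e \<notin> S"
proof (rule ccontr)
  interpret wf_digraph D by fact
  assume "\<not> ?thesis"
  hence "\<forall>v \<in> S. \<exists>e. e \<in> X \<and> tail D e = v \<and> head D e \<in> S"
    by blast
  then obtain g where g: "\<forall>v \<in> S. g v \<in> X \<and> tail D (g v) = v \<and> head D (g v) \<in> S"
    by metis
  define s where "s = (\<lambda>v. head D (g v))"
  have s: "s v \<in> S" if "v \<in> S" for v
    using g that by (simp add: s_def)
  have sn: "(s ^^ k) v \<in> S" if "v \<in> S" for v k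
    using that by (induction k) (auto intro: s)
  have X: "X \<subseteq> arcs D"
    using assms(2) by (simp add: acyclic_arcs_def)
  have walk: "awalk v (map (\<lambda>j. g ((s ^^ j) v)) [0..<k]) ((s ^^ k) v)" if "v \<in> S" for v k
  proof (induction k)
    case 0
    show ?case using that assms(5) by (auto simp: awalk_Nil_iff)
  next
    case (Suc k)
    have "awalk ((s ^^ k) v) [g ((s ^^ k) v)] ((s ^^ Suc k) v)"
      using g sn[OF that, of k] X assms(5) s[OF sn[OF that, of k]]
      by (auto simp: awalk_Cons_iff awalk_Nil_iff s_def)
    with Suc show ?case by auto
  qed
  \<comment> \<open>By the pigeonhole principle, the walk that starts in \<open>x\<close> revisits a vertex.\<close>
  obtain x where x: "x \<in> S" using assms(4) by blast
  have "\<not> inj (\<lambda>k. (s ^^ k) x)"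
    using sn[OF x] finite_subset[OF _ assms(3), of "range (\<lambda>k. (s ^^ k) x)"]
    by (auto dest: finite_imageD)
  then obtain i j where ij: "i < j" "(s ^^ i) x = (s ^^ j) x"
    using linorder_injI[of "\<lambda>k. (s ^^ k) x"] by blast
  let ?v = "(s ^^ i) x"
  let ?p = "map (\<lambda>k. g ((s ^^ k) ?v)) [0..<j - i]"
  have "(s ^^ (j - i)) ?v = ?v"
    using ij by (metis add_diff_inverse_nat add.commute comp_apply funpow_add less_imp_not_less)
  hence "awalk ?v ?p ?v"
    using walk[OF sn[OF x], of i "j - i"] by simp
  moreover have "set ?p \<subseteq> X"
    using g sn[OF sn[OF x]] by auto
  ultimately have "?p = []"
    using acyclic_arcs_no_closed_walk[OF assms(1,2)] by blast
  thus False using ij by simp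
qed

text \<open>
  Repeatedly removing a vertex that has at most one arc into the set of remaining vertices ranks the
  vertices by the time of their removal.  The arcs from a vertex to vertices of higher rank are
  those into the set remaining after its removal, so there is at most one of them.
\<close>

lemma exists_peeling_rank:
  assumes "finite (arcs D)" "finite S"
    and "\<And>T. \<lbrakk>T \<subseteq> S; T \<noteq> {}\<rbrakk> \<Longrightarrow> \<not> two_out_closed D T"
  shows "\<exists>r :: 'a \<Rightarrow> nat. inj_on r S \<and>
    (\<forall>v \<in> S. card {e \<in> arcs D. tail D e = v \<and> head D e \<in> S \<and> r v < r (head D e)} \<le> 1)"
  using assms(2,3)
proof (induction "card S" arbitrary: S)
  case 0
  thus ?case by auto
next
  case (Suc k)
  have "S \<noteq> {}" using Suc.hyps(2) by auto
  hence "\<not> two_out_closed D S" using Suc.prems(2) by blast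
  then obtain v where v: "v \<in> S" "card {e \<in> arcs D. tail D e = v \<and> head D e \<in> S} \<le> 1"
    by (force simp: two_out_closed_def)
  have "k = card (S - {v})" using Suc.hyps(2) v(1) by simp
  moreover have "\<And>T. \<lbrakk>T \<subseteq> S - {v}; T \<noteq> {}\<rbrakk> \<Longrightarrow> \<not> two_out_closed D T"
    using Suc.prems(2) by blast
  ultimately obtain r :: "'a \<Rightarrow> nat" where r: "inj_on r (S - {v})"
    "\<forall>x \<in> S - {v}. card {e \<in> arcs D. tail D e = x \<and> head D e \<in> S - {v} \<and> r x < r (head D e)} \<le> 1"
    using Suc.hyps(1)[of "S - {v}"] Suc.prems(1) by blast
  define r' where "r' = (\<lambda>x. if x = v then 0 else Suc (r x))"
  have "inj_on r' S"
    using r(1) by (auto simp: inj_on_def r'_def)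
  moreover have "card {e \<in> arcs D. tail D e = x \<and> head D e \<in> S \<and> r' x < r' (head D e)} \<le> 1"
    if "x \<in> S" for x
  proof (cases "x = v")
    case True
    have "card {e \<in> arcs D. tail D e = x \<and> head D e \<in> S \<and> r' x < r' (head D e)}
        \<le> card {e \<in> arcs D. tail D e = v \<and> head D e \<in> S}"
      using True assms(1) by (intro card_mono) auto
    thus ?thesis using v(2) by simp
  next
    case False
    hence "{e \<in> arcs D. tail D e = x \<and> head D e \<in> S \<and> r' x < r' (head D e)}
        = {e \<in> arcs D. tail D e = x \<and> head D e \<in> S - {v} \<and> r x < r (head D e)}"
      by (auto simp: r'_def split: if_splits)
    thus ?thesis using r(2) that False by simp
  qed
  ultimately show ?case by blast
qed

theorem branching_acyclic_partition_iff:
  assumes "fin_digraph D" "loopfree_digraph D"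
  shows "has_branching_acyclic_partition D \<longleftrightarrow>
    \<not> (\<exists>S. S \<subseteq> verts D \<and> S \<noteq> {} \<and> two_out_closed D S)"
proof
  interpret fin_digraph D by fact
  assume "has_branching_acyclic_partition D"
  then obtain B C where BC: "B \<union> C = arcs D" "in_branching D B" "acyclic_arcs D C"
    by (auto simp: has_branching_acyclic_partition_def)
  show "\<not> (\<exists>S. S \<subseteq> verts D \<and> S \<noteq> {} \<and> two_out_closed D S)"
  proof
    assume "\<exists>S. S \<subseteq> verts D \<and> S \<noteq> {} \<and> two_out_closed D S"
    then obtain S where S: "S \<subseteq> verts D" "S \<noteq> {}" "two_out_closed D S" by blast
    have "finite S" using S(1) finite_subset by fastforce
    then obtain v where v: "v \<in> S" "\<forall>e \<in> C. tail D e = v \<longrightarrow> head D e \<notin> S"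
      using acyclic_arcs_sink[OF wf_digraph BC(3)] S by blast
    let ?E = "{e \<in> arcs D. tail D e = v \<and> head D e \<in> S}"
    have "?E \<subseteq> B" using BC(1) v(2) by blast
    hence "e = e'" if "e \<in> ?E" "e' \<in> ?E" for e e'
      using that BC(2) unfolding in_branching_def by blast
    hence "card ?E \<le> 1" by (simp add: card_le_Suc0_iff_eq)
    moreover have "2 \<le> card ?E" using S(3) v(1) by (auto simp: two_out_closed_def)
    ultimately show False by simp
  qed
next
  interpret fin_digraph D by fact
  interpret loopfree_digraph D by fact
  assume "\<not> (\<exists>S. S \<subseteq> verts D \<and> S \<noteq> {} \<and> two_out_closed D S)"
  hence "\<exists>r :: 'a \<Rightarrow> nat. inj_on r (verts D) \<and>
    (\<forall>v \<in> verts D. card {e \<in> arcs D. tail D e = v \<and> head D e \<in> verts D \<and> r v < r (head D e)} \<le> 1)"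
    by (intro exists_peeling_rank) auto
  then obtain r :: "'a \<Rightarrow> nat" where r: "inj_on r (verts D)"
    "\<And>v. v \<in> verts D \<Longrightarrow>
       card {e \<in> arcs D. tail D e = v \<and> head D e \<in> verts D \<and> r v < r (head D e)} \<le> 1"
    by auto
  define B where "B = {e \<in> arcs D. r (tail D e) < r (head D e)}"
  define C where "C = {e \<in> arcs D. r (head D e) < r (tail D e)}"
  have "r (tail D e) \<noteq> r (head D e)" if "e \<in> arcs D" for e
    using that no_loops[OF that] r(1) by (auto simp: inj_on_def)
  hence "B \<union> C = arcs D" by (auto simp: B_def C_def nat_neq_iff)
  moreover have "B \<inter> C = {}" by (auto simp: B_def C_def)
  moreover have "acyclic_arcs D B"
    by (rule acyclic_arcs_if_increasing[OF wf_digraph, of _ r]) (auto simp: B_def)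
  moreover have "acyclic_arcs D C"
    by (rule acyclic_arcs_if_decreasing[OF wf_digraph, of _ r]) (auto simp: C_def)
  moreover have "e = e'" if "e \<in> B" "e' \<in> B" "tail D e = tail D e'" for e e'
  proof -
    let ?E = "{x \<in> arcs D. tail D x = tail D e \<and> head D x \<in> verts D \<and> r (tail D e) < r (head D x)}"
    have "e \<in> ?E" "e' \<in> ?E" using that by (auto simp: B_def)
    moreover have "card ?E \<le> Suc 0" using r(2)[of "tail D e"] that(1) by (auto simp: B_def)
    ultimately show ?thesis by (simp add: card_le_Suc0_iff_eq)
  qed
  ultimately have "in_branching D B \<and> acyclic_arcs D C \<and> B \<union> C = arcs D \<and> B \<inter> C = {}"
    unfolding in_branching_def by simp
  thus "has_branching_acyclic_partition D"
    unfolding has_branching_acyclic_partition_def by (intro exI[of _ B] exI[of _ C]) simp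
qed

section \<open>Peeling in rounds\<close>

text \<open>
  Possible arcs of a loop-free digraph on the vertices below \<open>n\<close>.
\<close>

definition proper_arc :: "nat \<Rightarrow> nat \<times> nat \<Rightarrow> bool" where
  "proper_arc n e \<longleftrightarrow> fst e < n \<and> snd e < n \<and> fst e \<noteq> snd e"

text \<open>
  The number of list entries that lead from \<open>v\<close> into \<open>S\<close>.
\<close>

definition outs :: "(nat \<times> nat) list \<Rightarrow> nat set \<Rightarrow> nat \<Rightarrow> nat" where
  "outs es S v = length (filter (\<lambda>e. fst e = v \<and> snd e \<in> S) es)"

text \<open>
  The vertices that survive one round of peeling when \<open>S\<close> is the set of vertices still present.
  A round tests all \<open>v < n\<close>, including those outside \<open>S\<close>; since \<open>prune\<close> is monotone, iterating it
  from the full vertex set nevertheless gives a decreasing sequence.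
\<close>

definition prune :: "nat \<Rightarrow> (nat \<times> nat) list \<Rightarrow> nat set \<Rightarrow> nat set" where
  "prune n es S = {v. v < n \<and> 2 \<le> outs es S v}"

text \<open>
  Starting from \<open>V\<close> with \<open>F V \<subseteq> V\<close>, the iterates of a monotone \<open>F\<close> decrease and lose an
  element in each round until they reach the largest \<open>S \<subseteq> V\<close> with \<open>S \<subseteq> F S\<close>, which happens after at most
  \<open>card V\<close> rounds.
\<close>

lemma funpow_eq_empty_iff:
  fixes F :: "'a set \<Rightarrow> 'a set"
  assumes "mono F" "finite V" "F V \<subseteq> V" "card V \<le> k"
  shows "(F ^^ k) V = {} \<longleftrightarrow> \<not> (\<exists>S. S \<subseteq> V \<and> S \<noteq> {} \<and> S \<subseteq> F S)"
proof
  assume empty: "(F ^^ k) V = {}"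
  have "S \<subseteq> (F ^^ j) V" if "S \<subseteq> V" "S \<subseteq> F S" for S j
  proof (induction j)
    case 0
    show ?case using that(1) by simp
  next
    case (Suc j)
    show ?case using order_trans[OF that(2) monoD[OF assms(1) Suc.IH]] by simp
  qed
  thus "\<not> (\<exists>S. S \<subseteq> V \<and> S \<noteq> {} \<and> S \<subseteq> F S)"
    using empty by blast
next
  assume none: "\<not> (\<exists>S. S \<subseteq> V \<and> S \<noteq> {} \<and> S \<subseteq> F S)"
  have dec: "(F ^^ Suc j) V \<subseteq> (F ^^ j) V" for j
  proof (induction j)
    case 0
    show ?case using assms(3) by simp
  next
    case (Suc j)
    show ?case using monoD[OF assms(1) Suc.IH] by simp
  qed
  have sub: "(F ^^ j) V \<subseteq> V" for j
  proof (induction j)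
    case (Suc j)
    thus ?case using dec[of j] by blast
  qed simp
  have strict: "card ((F ^^ Suc j) V) < card ((F ^^ j) V)" if "(F ^^ j) V \<noteq> {}" for j
  proof -
    have "(F ^^ Suc j) V \<noteq> (F ^^ j) V"
      using none sub[of j] that by auto
    hence "(F ^^ Suc j) V \<subset> (F ^^ j) V"
      using dec[of j] by blast
    thus ?thesis
      using finite_subset[OF sub[of j] assms(2)] by (rule psubset_card_mono[rotated])
  qed
  have "card ((F ^^ j) V) \<le> card V - j" for j
  proof (induction j)
    case 0
    show ?case by simp
  next
    case (Suc j)
    show ?case
    proof (cases "(F ^^ j) V = {}")
      case True
      thus ?thesis using dec[of j] by simp
    next
      case False
      from strict[OF this] Suc.IH show ?thesis by simp
    qed
  qed
  from this[of k] have "card ((F ^^ k) V) = 0"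
    using assms(4) by simp
  thus "(F ^^ k) V = {}"
    using finite_subset[OF sub[of k] assms(2)] by simp
qed

lemma outs_mono: "S \<subseteq> T \<Longrightarrow> outs es S v \<le> outs es T v"
  unfolding outs_def by (induction es) auto

lemma mono_prune: "mono (prune n es)"
  unfolding mono_def prune_def using outs_mono order_trans by blast

lemma two_out_closed_list_digraph:
  "two_out_closed (list_digraph n es) S \<longleftrightarrow> (\<forall>v \<in> S. 2 \<le> outs es S v)"
proof -
  have "{i \<in> arcs (list_digraph n es). tail (list_digraph n es) i = v \<and> head (list_digraph n es) i \<in> S}
      = {i. i < length es \<and> fst (es ! i) = v \<and> snd (es ! i) \<in> S}" for v
    by (auto simp: list_digraph_def)
  thus ?thesis
    by (simp add: two_out_closed_def outs_def length_filter_conv_card)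
qed

lemma list_digraph_proper_iff:
  "fin_digraph (list_digraph n es) \<and> loopfree_digraph (list_digraph n es) \<longleftrightarrow>
    (\<forall>e \<in> set es. proper_arc n e)"
proof -
  have "fin_digraph (list_digraph n es) \<longleftrightarrow> wf_digraph (list_digraph n es)"
    by (auto simp: fin_digraph_def fin_digraph_axioms_def list_digraph_def)
  moreover have "loopfree_digraph (list_digraph n es) \<longleftrightarrow>
      wf_digraph (list_digraph n es) \<and> (\<forall>i < length es. fst (es ! i) \<noteq> snd (es ! i))"
    by (auto simp: loopfree_digraph_def loopfree_digraph_axioms_def list_digraph_def)
  moreover have "(\<forall>i < length es. fst (es ! i) \<noteq> snd (es ! i)) \<longleftrightarrow> (\<forall>e \<in> set es. fst e \<noteq> snd e)"
    by (simp add: all_set_conv_all_nth)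
  ultimately show ?thesis
    by (auto simp: list_digraph_wf_iff proper_arc_def)
qed

lemma has_partition_list_digraph_iff:
  assumes "\<forall>e \<in> set es. proper_arc n e"
  shows "has_branching_acyclic_partition (list_digraph n es) \<longleftrightarrow> (prune n es ^^ Suc n) {..<n} = {}"
proof -
  have verts: "verts (list_digraph n es) = {..<n}"
    by (simp add: list_digraph_def)
  have "has_branching_acyclic_partition (list_digraph n es) \<longleftrightarrow>
      \<not> (\<exists>S. S \<subseteq> {..<n} \<and> S \<noteq> {} \<and> (\<forall>v \<in> S. 2 \<le> outs es S v))"
    using branching_acyclic_partition_iff[of "list_digraph n es"] list_digraph_proper_iff[of n es] assms
    by (simp add: two_out_closed_list_digraph verts)
  also have "\<dots> \<longleftrightarrow> \<not> (\<exists>S. S \<subseteq> {..<n} \<and> S \<noteq> {} \<and> S \<subseteq> prune n es S)"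
  proof -
    have "(\<forall>v \<in> S. 2 \<le> outs es S v) \<longleftrightarrow> S \<subseteq> prune n es S" if "S \<subseteq> {..<n}" for S
      using that by (auto simp: prune_def)
    thus ?thesis by blast
  qed
  also have "\<dots> \<longleftrightarrow> (prune n es ^^ Suc n) {..<n} = {}"
    by (rule funpow_eq_empty_iff[OF mono_prune, symmetric]) (auto simp: prune_def)
  finally show ?thesis .
qed

section \<open>The Turing machine\<close>

text \<open>
  The machine has five tapes, named \<open>W\<close>, \<open>A\<close>, \<open>B\<close>, \<open>D\<close> and \<open>C\<close> in this order.  On \<open>A\<close> and
  \<open>B\<close>, cell \<open>v\<close> belongs to the vertex \<open>v\<close>.  The contents during the rounds are as follows.
  \<^item> Tape \<open>W\<close> holds the input.  The \<open>False\<close> that ends the number \<open>n\<close> of vertices is overwritten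
    by the symbol 3, which serves to find the start of the arc list again.
  \<^item> Tape \<open>A\<close> has, in the cell of each vertex \<open>v < n\<close>, a 2 if \<open>v\<close> is present and a 1 if it is
    removed.  All other cells are blank.
  \<^item> Tape \<open>B\<close> has, in the cell of each vertex \<open>v < n\<close>, one plus the number of arcs found so far
    from \<open>v\<close> to present vertices, counted up to 2.  All other cells are blank.
  \<^item> Tape \<open>D\<close> has a 1 in cell 0 and is blank elsewhere.  Its head moves right,
    along with that of \<open>B\<close>, while the first vertex of an arc is read; it moves left, while that of \<open>A\<close>
    moves right, as the second vertex is read.  So it is back in cell 0 exactly if the arc is a loop.
  \<^item> Tape \<open>C\<close> has a 2 in the cells from 0 to \<open>n\<close>.  Its head starts in cell \<open>n\<close> and moves one
    cell to the left in each round, which makes \<open>n + 1\<close> rounds.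

  \<open>SETUP\<close> reads \<open>n\<close>.  A round consists of the states \<open>TAIL\<close> and \<open>HEAD\<close>, which read the two vertices of an
  arc, \<open>BACK_HEAD\<close> and \<open>BACK_TAIL\<close>, which move the heads of \<open>A\<close> and \<open>B\<close> back to cell 0, and, after
  the last arc, \<open>UPDATE\<close>, which replaces \<open>A\<close> according to the counts on \<open>B\<close> and resets \<open>B\<close>,
  \<open>RETURN\<close>, which moves the heads of \<open>A\<close> and \<open>B\<close> back, and \<open>SEEK\<close>, which moves the head of
  \<open>W\<close> back.  \<open>FINAL\<close> tests whether all vertices are removed.  A vertex that is out of range shows
  up as a blank cell of \<open>A\<close> or \<open>B\<close>.
\<close>

abbreviation (input) SETUP :: nat where "SETUP \<equiv> 0"
abbreviation (input) TAIL :: nat where "TAIL \<equiv> 1"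
abbreviation (input) HEAD :: nat where "HEAD \<equiv> 2"
abbreviation (input) BACK_HEAD :: nat where "BACK_HEAD \<equiv> 3"
abbreviation (input) BACK_TAIL :: nat where "BACK_TAIL \<equiv> 4"
abbreviation (input) UPDATE :: nat where "UPDATE \<equiv> 5"
abbreviation (input) RETURN :: nat where "RETURN \<equiv> 6"
abbreviation (input) SEEK :: nat where "SEEK \<equiv> 7"
abbreviation (input) FINAL :: nat where "FINAL \<equiv> 8"
abbreviation (input) ACCEPT :: nat where "ACCEPT \<equiv> 9"
abbreviation (input) REJECT :: nat where "REJECT \<equiv> 10"

text \<open>
  In a configuration with read symbols \<open>w, a, b, d, c\<close>, writing back the symbol just read leaves a
  tape unchanged.  At the end of the input in state \<open>TAIL\<close>, \<open>d = 1\<close> says that no part of a tail has been read, so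
  that the input ends between two arcs.
\<close>

definition peel_delta :: "nat \<Rightarrow> nat list \<Rightarrow> nat \<times> (nat \<times> direction) list" where
  "peel_delta q xs =
    (let w = xs ! 0; a = xs ! 1; b = xs ! 2; d = xs ! 3; c = xs ! 4;
         go = (\<lambda>q'. (q', [(w, Stay), (a, Stay), (b, Stay), (d, Stay), (c, Stay)]))
     in
       if q = SETUP then
         if w = 2 then (SETUP, [(w, Right), (2, Right), (1, Right), (d, Stay), (2, Right)])
         else if w = 1 then (RETURN, [(3, Stay), (a, Left), (b, Left), (1, Stay), (2, Stay)])
         else go REJECT
       else if q = TAIL then
         if w = 2 then (TAIL, [(w, Right), (a, Stay), (b, Right), (d, Right), (c, Stay)])
         else if w = 1 \<and> b \<noteq> 0 then (HEAD, [(w, Right), (a, Stay), (b, Stay), (d, Stay), (c, Stay)])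
         else if w = 0 \<and> d = 1 then go UPDATE
         else go REJECT
       else if q = HEAD then
         if w = 2 then (HEAD, [(w, Right), (a, Right), (b, Stay), (d, Left), (c, Stay)])
         else if w = 1 \<and> a \<noteq> 0 \<and> d \<noteq> 1 then
           (BACK_HEAD, [(w, Right), (a, Stay), (if a = 2 then min 3 (b + 1) else b, Stay),
                        (d, Stay), (c, Stay)])
         else go REJECT
       else if q = BACK_HEAD then
         if a \<noteq> 0 then (BACK_HEAD, [(w, Stay), (a, Left), (b, Stay), (d, Right), (c, Stay)])
         else (BACK_TAIL, [(w, Stay), (a, Right), (b, Stay), (d, Left), (c, Stay)])
       else if q = BACK_TAIL then
         if b \<noteq> 0 then (BACK_TAIL, [(w, Stay), (a, Stay), (b, Left), (d, Left), (c, Stay)])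
         else (TAIL, [(w, Stay), (a, Stay), (b, Right), (d, Right), (c, Stay)])
       else if q = UPDATE then
         if b \<noteq> 0 then
           (UPDATE, [(w, Stay), (if b = 3 then 2 else 1, Right), (1, Right), (d, Stay), (c, Stay)])
         else (RETURN, [(w, Stay), (a, Left), (b, Left), (d, Stay), (c, Stay)])
       else if q = RETURN then
         if a \<noteq> 0 then (RETURN, [(w, Stay), (a, Left), (b, Left), (d, Stay), (c, Stay)])
         else (SEEK, [(w, Stay), (a, Right), (b, Right), (d, Stay), (c, Stay)])
       else if q = SEEK then
         if w \<noteq> 3 then (SEEK, [(w, Left), (a, Stay), (b, Stay), (d, Stay), (c, Stay)])
         else if c \<noteq> 0 then (TAIL, [(w, Right), (a, Stay), (b, Stay), (d, Stay), (c, Left)])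
         else go FINAL
       else
         if a = 1 then (FINAL, [(w, Stay), (a, Right), (b, Stay), (d, Stay), (c, Stay)])
         else if a = 0 then go ACCEPT
         else go REJECT)"

text \<open>
  Besides the blank and the two input bits, the symbol 3 occurs as the mark on \<open>W\<close> and as the
  largest entry of \<open>B\<close>.
\<close>

definition peel_tm :: tm where
  "peel_tm = \<lparr>tm_tapes = 5, tm_symbols = 4, tm_states = 11, tm_start = SETUP,
     tm_accept = ACCEPT, tm_reject = REJECT, tm_delta = peel_delta\<rparr>"

lemma tm_wf_peel_tm: "tm_wf peel_tm"
proof -
  define valid :: "nat \<times> (nat \<times> direction) list \<Rightarrow> bool" where
    "valid = (\<lambda>(q', as). q' < 11 \<and> length as = 5 \<and> (\<forall>(y, d) \<in> set as. y < 4))"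
  have if_valid: "valid (if P then r else s)" if "valid r" "valid s" for P r s
    using that by simp
  have "valid (peel_delta q xs)" if "length xs = 5" "\<forall>x \<in> set xs. x < 4" for q and xs :: "nat list"
  proof -
    have "xs ! 0 < 4" "xs ! 1 < 4" "xs ! 2 < 4" "xs ! 3 < 4" "xs ! 4 < 4"
      using that by simp_all
    thus ?thesis
      unfolding peel_delta_def Let_def by (intro if_valid) (simp_all add: valid_def min_def)
  qed
  thus ?thesis
    by (simp add: tm_wf_def peel_tm_def valid_def)
qed

section \<open>Bounded reachability\<close>

text \<open>
  \<open>c'\<close> is reached from \<open>c\<close> within at most \<open>t\<close> steps.  Upper bounds suffice because final
  configurations are fixed points.
\<close>

definition reach :: "config \<Rightarrow> nat \<Rightarrow> config \<Rightarrow> bool" where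
  "reach c t c' \<longleftrightarrow> (\<exists>k \<le> t. (tm_step peel_tm ^^ k) c = c')"

text \<open>
  The machine rejects within at most \<open>t\<close> steps from \<open>c\<close>.
\<close>

definition rejects :: "config \<Rightarrow> nat \<Rightarrow> bool" where
  "rejects c t \<longleftrightarrow> (\<exists>c'. reach c t c' \<and> fst c' = REJECT)"

lemma reach_refl: "reach c t c"
  unfolding reach_def by (intro exI[of _ 0]) simp

lemma reach_mono: "reach c s c' \<Longrightarrow> s \<le> t \<Longrightarrow> reach c t c'"
  unfolding reach_def using order_trans by blast

lemma reach_trans:
  assumes "reach c s c'" "reach c' t c''"
  shows "reach c (s + t) c''"
proof -
  obtain j k where "j \<le> s" "(tm_step peel_tm ^^ j) c = c'" "k \<le> t" "(tm_step peel_tm ^^ k) c' = c''"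
    using assms by (auto simp: reach_def)
  thus ?thesis
    unfolding reach_def by (intro exI[of _ "k + j"]) (auto simp: funpow_add)
qed

lemma reach_step: "reach c 1 (tm_step peel_tm c)"
  unfolding reach_def by (intro exI[of _ 1]) simp

lemma reach_step_trans: "tm_step peel_tm c = c' \<Longrightarrow> reach c' t c'' \<Longrightarrow> reach c (Suc t) c''"
  using reach_trans[OF reach_step, of c t c''] by simp

lemma rejects_step: "fst (tm_step peel_tm c) = REJECT \<Longrightarrow> rejects c 1"
  unfolding rejects_def using reach_step by blast

lemma rejects_trans: "reach c s c' \<Longrightarrow> rejects c' t \<Longrightarrow> rejects c (s + t)"
  unfolding rejects_def using reach_trans by blast

lemma rejects_step_trans: "tm_step peel_tm c = c' \<Longrightarrow> rejects c' t \<Longrightarrow> rejects c (Suc t)"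
  unfolding rejects_def using reach_step_trans by blast

lemma rejects_mono: "rejects c s \<Longrightarrow> s \<le> t \<Longrightarrow> rejects c t"
  unfolding rejects_def using reach_mono by blast

lemmas step_simps = tm_step_def peel_tm_def peel_delta_def tape_read_def tape_act_def Let_def
  fun_upd_idem

section \<open>Tape contents\<close>

text \<open>
  The tape that holds \<open>f 0, \<dots>, f (n - 1)\<close> and is blank elsewhere.
\<close>

definition arr :: "nat \<Rightarrow> (nat \<Rightarrow> nat) \<Rightarrow> int \<Rightarrow> nat" where
  "arr n f i = (if 0 \<le> i \<and> i < int n then f (nat i) else 0)"

lemma arr_cong: "(\<And>j. j < n \<Longrightarrow> f j = g j) \<Longrightarrow> arr n f = arr n g"
  by (auto simp: arr_def fun_eq_iff)

lemma arr_int: "arr n f (int j) = (if j < n then f j else 0)"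
  by (simp add: arr_def)

lemma arr_neg: "i < 0 \<Longrightarrow> arr n f i = 0"
  by (simp add: arr_def)

lemma arr_update: "j < n \<Longrightarrow> (arr n f)(int j := y) = arr n (f(j := y))"
  by (auto simp: arr_def fun_eq_iff)

lemma arr_extend: "(arr n (\<lambda>_. y))(int n := y) = arr (Suc n) (\<lambda>_. y)"
  by (auto simp: arr_def fun_eq_iff)

text \<open>
  The entries of tape \<open>A\<close> when \<open>S\<close> is the set of present vertices.
\<close>

definition mark :: "nat set \<Rightarrow> nat \<Rightarrow> nat" where
  "mark S v = (if v \<in> S then 2 else 1)"

text \<open>
  The entries of tape \<open>B\<close> when \<open>h v\<close> arcs have been counted for \<open>v\<close>.  Adding one keeps them apart
  from the blank.
\<close>

definition tally :: "(nat \<Rightarrow> nat) \<Rightarrow> nat \<Rightarrow> nat" where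
  "tally h v = Suc (min 2 (h v))"

text \<open>
  The content of tape \<open>D\<close>.
\<close>

definition origin :: "int \<Rightarrow> nat" where
  "origin i = (if i = 0 then 1 else 0)"

lemma mark_pos: "0 < mark S v"
  by (simp add: mark_def)

lemma tally_pos: "0 < tally h v"
  by (simp add: tally_def)

text \<open>
  The cells from \<open>i\<close> on hold the string \<open>ws\<close>.
\<close>

definition reads :: "(int \<Rightarrow> nat) \<Rightarrow> int \<Rightarrow> bool list \<Rightarrow> bool" where
  "reads W i ws \<longleftrightarrow> (\<forall>j < length ws. W (i + int j) = (if ws ! j then 2 else 1))"

lemma reads_Nil [simp]: "reads W i []"
  by (simp add: reads_def)

lemma reads_Cons [simp]: "reads W i (b # ws) \<longleftrightarrow> W i = (if b then 2 else 1) \<and> reads W (i + 1) ws"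
  by (simp add: reads_def All_less_Suc2 add.assoc)

lemma reads_append [simp]:
  "reads W i (vs @ ws) \<longleftrightarrow> reads W i vs \<and> reads W (i + int (length vs)) ws"
  by (induction vs arbitrary: i) (auto simp: add.assoc)

lemma bool_list_cases:
  obtains (ones) k where "ws = replicate k True" | (block) k ws' where "ws = unary k @ ws'"
proof (cases "False \<in> set ws")
  case True
  then obtain vs ws' where "ws = vs @ False # ws'" "False \<notin> set vs"
    by (meson split_list_first)
  moreover from this have "vs = replicate (length vs) True"
    by (metis (full_types) replicate_eqI)
  ultimately have "ws = unary (length vs) @ ws'"
    by (simp add: unary_def)
  thus ?thesis by (rule block)
next
  case False
  hence "ws = replicate (length ws) True"
    by (metis (full_types) replicate_eqI)
  thus ?thesis by (rule ones)
qed

section \<open>The loops of the machine\<close>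

text \<open>
  The following lemmas describe the loops of the single states.
\<close>

lemma run_setup:
  assumes "reads W (int k) (replicate m True)"
  shows "reach (SETUP, [(W, int k), (arr k (\<lambda>_. 2), int k), (arr k (\<lambda>_. 1), int k),
                        (D, d), (arr k (\<lambda>_. 2), int k)]) m
    (SETUP, [(W, int (k + m)), (arr (k + m) (\<lambda>_. 2), int (k + m)), (arr (k + m) (\<lambda>_. 1), int (k + m)),
             (D, d), (arr (k + m) (\<lambda>_. 2), int (k + m))])"
  using assms
proof (induction m arbitrary: k)
  case 0
  show ?case by (simp add: reach_refl)
next
  case (Suc m)
  have "reads W (int (Suc k)) (replicate m True)" "W (int k) = 2"
    using Suc.prems by (simp_all add: add.commute)
  from Suc.IH[OF this(1)] this(2) show ?case
    by (intro reach_step_trans) (auto simp: step_simps arr_extend add.commute)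
qed

lemma run_tail:
  assumes "reads W i (replicate m True)"
  shows "reach (TAIL, [(W, i), T, (B, b), (D, d), C]) m
    (TAIL, [(W, i + int m), T, (B, b + int m), (D, d + int m), C])"
  using assms
proof (induction m arbitrary: i b d)
  case 0
  show ?case by (simp add: reach_refl)
next
  case (Suc m)
  have "tm_step peel_tm (TAIL, [(W, i), T, (B, b), (D, d), C]) =
      (TAIL, [(W, i + 1), T, (B, b + 1), (D, d + 1), C])"
    using Suc.prems by (simp add: step_simps)
  from reach_step_trans[OF this Suc.IH] Suc.prems show ?case
    by (simp add: add.assoc)
qed

lemma run_head:
  assumes "reads W i (replicate m True)"
  shows "reach (HEAD, [(W, i), (A, a), T, (D, d), C]) m
    (HEAD, [(W, i + int m), (A, a + int m), T, (D, d - int m), C])"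
  using assms
proof (induction m arbitrary: i a d)
  case 0
  show ?case by (simp add: reach_refl)
next
  case (Suc m)
  have "tm_step peel_tm (HEAD, [(W, i), (A, a), T, (D, d), C]) =
      (HEAD, [(W, i + 1), (A, a + 1), T, (D, d - 1), C])"
    using Suc.prems by (simp add: step_simps)
  from reach_step_trans[OF this Suc.IH] Suc.prems show ?case
    by (simp add: algebra_simps)
qed

text \<open>
  The head of \<open>A\<close> moves left until it leaves the vertex cells and then one step back, which is why
  it starts at \<open>int k - 1\<close>: in this form \<open>k = 0\<close> is the final step.  The same holds for the other
  two loops that move heads back.
\<close>

lemma run_back_head:
  assumes "k \<le> n"
  shows "reach (BACK_HEAD, [W, (arr n (mark S), int k - 1), T, (D, d), C]) (Suc k)
    (BACK_TAIL, [W, (arr n (mark S), 0), T, (D, d + int k - 1), C])"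
  using assms
proof (induction k arbitrary: d)
  case 0
  show ?case
    by (rule reach_step_trans[OF _ reach_refl]) (simp add: step_simps arr_neg)
next
  case (Suc k)
  have "tm_step peel_tm (BACK_HEAD, [W, (arr n (mark S), int k), T, (D, d), C]) =
      (BACK_HEAD, [W, (arr n (mark S), int k - 1), T, (D, d + 1), C])"
    using Suc.prems mark_pos[of S k] by (simp add: step_simps arr_int)
  from reach_step_trans[OF this Suc.IH] Suc.prems show ?case
    by simp
qed

lemma run_back_tail:
  assumes "k \<le> n"
  shows "reach (BACK_TAIL, [W, T, (arr n (tally h), int k - 1), (D, d), C]) (Suc k)
    (TAIL, [W, T, (arr n (tally h), 0), (D, d - int k + 1), C])"
  using assms
proof (induction k arbitrary: d)
  case 0
  show ?case
    by (rule reach_step_trans[OF _ reach_refl]) (simp add: step_simps arr_neg)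
next
  case (Suc k)
  have "tm_step peel_tm (BACK_TAIL, [W, T, (arr n (tally h), int k), (D, d), C]) =
      (BACK_TAIL, [W, T, (arr n (tally h), int k - 1), (D, d - 1), C])"
    using Suc.prems tally_pos[of h k] by (simp add: step_simps arr_int)
  from reach_step_trans[OF this Suc.IH] Suc.prems show ?case
    by simp
qed

lemma run_return:
  assumes "k \<le> n"
  shows "reach (RETURN, [W, (arr n (mark S), int k - 1), (B, int k - 1), D, C]) (Suc k)
    (SEEK, [W, (arr n (mark S), 0), (B, 0), D, C])"
  using assms
proof (induction k)
  case 0
  show ?case
    by (rule reach_step_trans[OF _ reach_refl]) (simp add: step_simps arr_neg)
next
  case (Suc k)
  have "tm_step peel_tm (RETURN, [W, (arr n (mark S), int k), (B, int k), D, C]) =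
      (RETURN, [W, (arr n (mark S), int k - 1), (B, int k - 1), D, C])"
    using Suc.prems mark_pos[of S k] by (simp add: step_simps arr_int)
  from reach_step_trans[OF this Suc.IH] Suc.prems show ?case
    by simp
qed

lemma run_seek:
  assumes "\<And>j. 0 < j \<Longrightarrow> j \<le> m \<Longrightarrow> W (i + int j) \<noteq> 3"
  shows "reach (SEEK, [(W, i + int m), A, B, D, C]) m (SEEK, [(W, i), A, B, D, C])"
  using assms
proof (induction m)
  case 0
  show ?case by (simp add: reach_refl)
next
  case (Suc m)
  have "tm_step peel_tm (SEEK, [(W, i + int (Suc m)), A, B, D, C]) =
      (SEEK, [(W, i + int m), A, B, D, C])"
    using Suc.prems[of "Suc m"] by (simp add: step_simps)
  from reach_step_trans[OF this Suc.IH] Suc.prems show ?case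
    by simp
qed

lemma update_step:
  assumes "m < n"
  shows "tm_step peel_tm (UPDATE, [W, (arr n (mark S), int m), (arr n (tally h), int m), D, C]) =
    (UPDATE, [W, (arr n (mark (if 2 \<le> h m then insert m S else S - {m})), int (Suc m)),
              (arr n (tally (h(m := 0))), int (Suc m)), D, C])"
proof -
  have "arr n (tally h) (int m) = 3 \<longleftrightarrow> 2 \<le> h m" "arr n (tally h) (int m) \<noteq> 0"
    using assms by (auto simp: arr_int tally_def)
  moreover have "(mark S)(m := 2) = mark (insert m S)" "(mark S)(m := 1) = mark (S - {m})"
    "(tally h)(m := 1) = tally (h(m := 0))"
    by (auto simp: mark_def tally_def fun_eq_iff)
  ultimately show ?thesis
    using assms by (simp add: step_simps arr_update add.commute)
qed

lemma run_update:
  assumes "m \<le> n"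
  shows "reach (UPDATE, [W, (arr n (mark S), 0), (arr n (tally h), 0), D, C]) m
    (UPDATE, [W, (arr n (mark ({v. v < m \<and> 2 \<le> h v} \<union> (S - {..<m}))), int m),
              (arr n (tally (\<lambda>v. if v < m then 0 else h v)), int m), D, C])"
  using assms
proof (induction m)
  case 0
  show ?case by (simp add: reach_refl)
next
  case (Suc m)
  let ?S = "\<lambda>m. {v. v < m \<and> 2 \<le> h v} \<union> (S - {..<m})"
  let ?h = "\<lambda>m v. if v < m then 0 else h v"
  have "(if 2 \<le> ?h m m then insert m (?S m) else ?S m - {m}) = ?S (Suc m)"
    by (auto simp: less_Suc_eq)
  moreover have "(?h m)(m := 0) = ?h (Suc m)"
    by (auto simp: fun_eq_iff less_Suc_eq)
  ultimately show ?case
    using reach_trans[OF Suc.IH reach_step] Suc.prems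
    by (simp only: update_step Suc_le_eq less_imp_le Suc_eq_plus1[symmetric])
qed

text \<open>
  The head of \<open>A\<close> passes removed vertices only.
\<close>

lemma run_final:
  assumes "m \<le> n" "\<And>j. j < m \<Longrightarrow> j \<notin> S"
  shows "reach (FINAL, [W, (arr n (mark S), 0), B, D, C]) m (FINAL, [W, (arr n (mark S), int m), B, D, C])"
  using assms
proof (induction m)
  case 0
  show ?case by (simp add: reach_refl)
next
  case (Suc m)
  have "tm_step peel_tm (FINAL, [W, (arr n (mark S), int m), B, D, C]) =
      (FINAL, [W, (arr n (mark S), int (Suc m)), B, D, C])"
    using Suc.prems by (simp add: step_simps arr_int mark_def add.commute)
  with reach_trans[OF Suc.IH reach_step] Suc.prems show ?case
    by simp
qed

section \<open>Reading the list of arcs\<close>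

text \<open>
  The part of the code of a digraph that follows the number of vertices.
\<close>

definition encode :: "(nat \<times> nat) list \<Rightarrow> bool list" where
  "encode es = concat (map (\<lambda>(u, v). unary u @ unary v) es)"

lemma digraph_code_encode: "digraph_code n es = unary n @ encode es"
  by (simp add: digraph_code_def encode_def)

lemma encode_Nil [simp]: "encode [] = []"
  by (simp add: encode_def)

lemma encode_Cons [simp]: "encode ((u, x) # es) = unary u @ unary x @ encode es"
  by (simp add: encode_def)

lemma length_unary [simp]: "length (unary k) = Suc k"
  by (simp add: unary_def)

lemma reads_unary:
  "reads W i (unary k) \<longleftrightarrow> reads W i (replicate k True) \<and> W (i + int k) = 1"
  by (simp add: unary_def)

text \<open>
  A proper arc \<open>(u, x)\<close> is read with the effect that the count of \<open>u\<close> grows by one if \<open>x\<close> is present.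
  The time is linear in the length \<open>u + x + 2\<close> of the code of the arc.
\<close>

lemma run_arc:
  assumes "u < n" "x < n" "u \<noteq> x" "reads W i (unary u @ unary x)"
  shows "reach (TAIL, [(W, i), (arr n (mark S), 0), (arr n (tally h), 0), (origin, 0), C])
      (3 * (u + x + 2))
    (TAIL, [(W, i + int (u + x + 2)), (arr n (mark S), 0),
            (arr n (tally (\<lambda>v. h v + (if v = u \<and> x \<in> S then 1 else 0))), 0), (origin, 0), C])"
proof -
  let ?A = "arr n (mark S)" and ?B = "arr n (tally h)"
  let ?h = "\<lambda>v. h v + (if v = u \<and> x \<in> S then 1 else 0)"
  let ?B' = "arr n (tally ?h)"
  let ?i = "i + int u + 1"
  have W: "reads W i (replicate u True)" "W (i + int u) = 1"
    "reads W ?i (replicate x True)" "W (?i + int x) = 1"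
    using assms(4) by (simp_all add: reads_unary algebra_simps)
  have B: "?B (int u) = tally h u" "?A (int x) = mark S x"
    using assms by (simp_all add: arr_int)
  \<comment> \<open>The symbol written by \<open>HEAD\<close> is the new count of \<open>u\<close>.\<close>
  have "(if mark S x = 2 then min 3 (tally h u + 1) else tally h u) = tally ?h u"
    by (auto simp: mark_def tally_def)
  moreover have "(tally h)(u := tally ?h u) = tally ?h"
    by (auto simp: tally_def fun_eq_iff)
  ultimately have B': "?B(int u := if mark S x = 2 then min 3 (tally h u + 1) else tally h u) = ?B'"
    using assms(1) by (simp add: arr_update)
  have "reach (TAIL, [(W, i), (?A, 0), (?B, 0), (origin, 0), C]) u
      (TAIL, [(W, i + int u), (?A, 0), (?B, int u), (origin, int u), C])"
    using run_tail[OF W(1), of "(?A, 0)" ?B 0 origin 0 C] by simp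
  moreover have "tm_step peel_tm (TAIL, [(W, i + int u), (?A, 0), (?B, int u), (origin, int u), C]) =
      (HEAD, [(W, ?i), (?A, 0), (?B, int u), (origin, int u), C])"
    using W(2) B(1) tally_pos[of h u] by (simp add: step_simps)
  moreover have "reach (HEAD, [(W, ?i), (?A, 0), (?B, int u), (origin, int u), C]) x
      (HEAD, [(W, ?i + int x), (?A, int x), (?B, int u), (origin, int u - int x), C])"
    using run_head[OF W(3), of ?A 0] by simp
  moreover have "tm_step peel_tm (HEAD, [(W, ?i + int x), (?A, int x), (?B, int u), (origin, int u - int x), C]) =
      (BACK_HEAD, [(W, ?i + int x + 1), (?A, int x),
        (?B(int u := if mark S x = 2 then min 3 (tally h u + 1) else tally h u), int u),
        (origin, int u - int x), C])"
    using W(4) B mark_pos[of S x] assms(3) by (simp add: step_simps origin_def)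
  note this[unfolded B']
  moreover have "reach
      (BACK_HEAD, [(W, ?i + int x + 1), (?A, int x), (?B', int u), (origin, int u - int x), C]) (x + 2)
      (BACK_TAIL, [(W, ?i + int x + 1), (?A, 0), (?B', int u), (origin, int u), C])"
    using run_back_head[of "Suc x" n _ S _ origin "int u - int x"] assms(2) by simp
  moreover have "reach (BACK_TAIL, [(W, ?i + int x + 1), (?A, 0), (?B', int u), (origin, int u), C]) (u + 2)
      (TAIL, [(W, ?i + int x + 1), (?A, 0), (?B', 0), (origin, 0), C])"
    using run_back_tail[of "Suc u" n _ _ ?h origin "int u"] assms(1) by simp
  ultimately have "reach (TAIL, [(W, i), (?A, 0), (?B, 0), (origin, 0), C])
      (u + Suc (x + Suc ((x + 2) + (u + 2))))
      (TAIL, [(W, ?i + int x + 1), (?A, 0), (?B', 0), (origin, 0), C])"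
    by (intro reach_trans[OF _ reach_step_trans[OF _ reach_trans[OF _ reach_step_trans[OF _ reach_trans]]]])
  hence "reach (TAIL, [(W, i), (?A, 0), (?B, 0), (origin, 0), C]) (3 * (u + x + 2))
      (TAIL, [(W, ?i + int x + 1), (?A, 0), (?B', 0), (origin, 0), C])"
    by (rule reach_mono) simp
  moreover have "?i + int x + 1 = i + int (u + x + 2)"
    by simp
  ultimately show ?thesis
    by (simp only:)
qed

lemma run_arcs:
  assumes "\<forall>e \<in> set es. proper_arc n e" "reads W i (encode es)"
  shows "reach (TAIL, [(W, i), (arr n (mark S), 0), (arr n (tally h), 0), (origin, 0), C])
      (3 * length (encode es))
    (TAIL, [(W, i + int (length (encode es))), (arr n (mark S), 0),
            (arr n (tally (\<lambda>v. h v + outs es S v)), 0), (origin, 0), C])"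
  using assms
proof (induction es arbitrary: i h)
  case Nil
  show ?case by (simp add: outs_def reach_refl)
next
  case (Cons e es)
  obtain u x where e: "e = (u, x)" by (cases e)
  let ?h = "\<lambda>v. h v + (if v = u \<and> x \<in> S then 1 else 0)"
  have "reach (TAIL, [(W, i), (arr n (mark S), 0), (arr n (tally h), 0), (origin, 0), C])
      (3 * (u + x + 2))
    (TAIL, [(W, i + int (u + x + 2)), (arr n (mark S), 0), (arr n (tally ?h), 0), (origin, 0), C])"
    using Cons.prems by (intro run_arc) (simp_all add: e proper_arc_def)
  moreover have "reads W (i + int (u + x + 2)) (encode es)"
    using Cons.prems(2) by (simp add: e algebra_simps)
  moreover have "(\<lambda>v. ?h v + outs es S v) = (\<lambda>v. h v + outs (e # es) S v)"
    by (auto simp: outs_def e fun_eq_iff)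
  moreover have "\<forall>e \<in> set es. proper_arc n e"
    using Cons.prems(1) by simp
  ultimately have "reach (TAIL, [(W, i), (arr n (mark S), 0), (arr n (tally h), 0), (origin, 0), C])
      (3 * (u + x + 2) + 3 * length (encode es))
    (TAIL, [(W, i + int (u + x + 2) + int (length (encode es))), (arr n (mark S), 0),
            (arr n (tally (\<lambda>v. h v + outs (e # es) S v)), 0), (origin, 0), C])"
    using reach_trans[OF _ Cons.IH[of "i + int (u + x + 2)" ?h]] by simp
  thus ?case
    by (simp add: e algebra_simps)
qed

text \<open>
  A string that is not a list of proper arcs is rejected: it either ends within an arc or contains,
  after some proper arcs, one with an end out of range or a loop.
\<close>

lemma rejects_improper:
  assumes "\<And>es. \<forall>e \<in> set es. proper_arc n e \<Longrightarrow> ws \<noteq> encode es"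
    and "reads W i ws" "W (i + int (length ws)) = 0"
  shows "rejects (TAIL, [(W, i), (arr n (mark S), 0), (arr n (tally h), 0), (origin, 0), C])
    (3 * length ws + 3)"
  using assms
proof (induction "length ws" arbitrary: ws i h rule: less_induct)
  case less
  let ?A = "arr n (mark S)" and ?B = "arr n (tally h)"
  let ?c = "(TAIL, [(W, i), (?A, 0), (?B, 0), (origin, 0), C])"
  have tail: "reach ?c u (TAIL, [(W, i + int u), (?A, 0), (?B, int u), (origin, int u), C])"
    if "reads W i (replicate u True)" for u
    using run_tail[OF that, of "(?A, 0)" ?B 0 origin 0 C] by simp
  show ?case
  proof (cases ws rule: bool_list_cases)
    case (ones u)
    hence "u \<noteq> 0" using less.prems(1)[of "[]"] by auto
    hence "rejects (TAIL, [(W, i + int u), (?A, 0), (?B, int u), (origin, int u), C]) 1"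
      using less.prems(3) ones by (intro rejects_step) (simp add: step_simps origin_def)
    hence "rejects ?c (u + 1)"
      using less.prems(2) ones by (intro rejects_trans[OF tail]) simp_all
    thus ?thesis by (rule rejects_mono) (simp add: ones)
  next
    case (block u vs)
    hence Wu: "reads W i (replicate u True)" "W (i + int u) = 1" and vs: "reads W (i + int u + 1) vs"
      using less.prems(2) by (simp_all add: reads_unary algebra_simps)
    show ?thesis
    proof (cases "u < n")
      case False
      hence "rejects (TAIL, [(W, i + int u), (?A, 0), (?B, int u), (origin, int u), C]) 1"
        using Wu(2) by (intro rejects_step) (simp add: step_simps arr_int)
      hence "rejects ?c (u + 1)" by (rule rejects_trans[OF tail[OF Wu(1)]])
      thus ?thesis by (rule rejects_mono) (simp add: block)
    next
      case u: True
      let ?i = "i + int u + 1"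
      have "tm_step peel_tm (TAIL, [(W, i + int u), (?A, 0), (?B, int u), (origin, int u), C]) =
          (HEAD, [(W, ?i), (?A, 0), (?B, int u), (origin, int u), C])"
        using Wu(2) u tally_pos[of h u] by (simp add: step_simps arr_int)
      note head0 = reach_trans[OF tail[OF Wu(1)] reach_step_trans[OF this reach_refl[of _ 0]]]
      have head: "reach ?c (u + 1 + x)
          (HEAD, [(W, ?i + int x), (?A, int x), (?B, int u), (origin, int u - int x), C])"
        if "reads W ?i (replicate x True)" for x
        using reach_trans[OF head0 run_head[OF that]] by simp
      show ?thesis
      proof (cases vs rule: bool_list_cases)
        case (ones x)
        have "W (?i + int x) = 0"
          using less.prems(3) by (simp add: block ones algebra_simps)
        hence "rejects (HEAD, [(W, ?i + int x), (?A, int x), (?B, int u), (origin, int u - int x), C]) 1"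
          by (intro rejects_step) (simp add: step_simps)
        hence "rejects ?c (u + 1 + x + 1)"
          using vs ones by (intro rejects_trans[OF head]) simp_all
        thus ?thesis by (rule rejects_mono) (simp add: block ones)
      next
        case (block x us)
        hence Wx: "reads W ?i (replicate x True)" "W (?i + int x) = 1"
          using vs by (simp_all add: reads_unary)
        have ws: "ws = unary u @ unary x @ us"
          using block \<open>ws = _\<close> by simp
        show ?thesis
        proof (cases "x < n \<and> u \<noteq> x")
          case False
          hence "rejects (HEAD, [(W, ?i + int x), (?A, int x), (?B, int u), (origin, int u - int x), C]) 1"
            using Wx(2) by (intro rejects_step) (auto simp: step_simps arr_int origin_def)
          hence "rejects ?c (u + 1 + x + 1)"
            by (rule rejects_trans[OF head[OF Wx(1)]])
          thus ?thesis by (rule rejects_mono) (simp add: ws)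
        next
          case True
          let ?h = "\<lambda>v. h v + (if v = u \<and> x \<in> S then 1 else 0)"
          have arc: "reach ?c (3 * (u + x + 2))
              (TAIL, [(W, i + int (u + x + 2)), (?A, 0), (arr n (tally ?h), 0), (origin, 0), C])"
            using u True less.prems(2) ws by (intro run_arc) simp_all
          have "rejects (TAIL, [(W, i + int (u + x + 2)), (?A, 0), (arr n (tally ?h), 0), (origin, 0), C])
              (3 * length us + 3)"
          proof (rule less.hyps)
            show "length us < length ws" by (simp add: ws)
            show "us \<noteq> encode es" if "\<forall>e \<in> set es. proper_arc n e" for es
              using less.prems(1)[of "(u, x) # es"] that u True by (auto simp: ws proper_arc_def)
            show "reads W (i + int (u + x + 2)) us" "W (i + int (u + x + 2) + int (length us)) = 0"
              using less.prems(2,3) by (simp_all add: ws algebra_simps)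
          qed
          from rejects_trans[OF arc this] show ?thesis
            by (rule rejects_mono) (simp add: ws)
        qed
      qed
    qed
  qed
qed

section \<open>Rounds of the machine\<close>

text \<open>
  The content of tape \<open>W\<close> after the setup, when \<open>ws\<close> is the part of the input behind the number \<open>n\<close>
  of vertices.
\<close>

definition marked_input :: "nat \<Rightarrow> bool list \<Rightarrow> int \<Rightarrow> nat" where
  "marked_input n ws = (fst (input_tape (unary n @ ws)))(int n := 3)"

lemma reads_input_tape: "reads (fst (input_tape w)) 0 w"
  by (simp add: reads_def input_tape_def)

lemma reads_marked_input: "reads (marked_input n ws) (int n + 1) ws"
proof -
  have "reads (fst (input_tape (unary n @ ws))) (int n + 1) ws"
    using reads_input_tape[of "unary n @ ws"] by (simp add: add.commute)
  thus ?thesis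
    by (simp add: reads_def marked_input_def)
qed

lemma marked_input_end: "marked_input n ws (int n + 1 + int (length ws)) = 0"
  by (simp add: marked_input_def input_tape_def)

lemma marked_input_marker: "marked_input n ws i = 3 \<longleftrightarrow> i = int n"
  by (simp add: marked_input_def input_tape_def)

text \<open>
  The configuration between two rounds, with present vertices \<open>S\<close>.  The head position \<open>c\<close> on
  tape \<open>C\<close> is the number of remaining rounds minus one.
\<close>

definition round_config :: "nat \<Rightarrow> bool list \<Rightarrow> nat set \<Rightarrow> int \<Rightarrow> config" where
  "round_config n ws S c =
    (SEEK, [(marked_input n ws, int n), (arr n (mark S), 0), (arr n (tally (\<lambda>_. 0)), 0),
            (origin, 0), (arr (Suc n) (\<lambda>_. 2), c)])"

lemma tm_init_peel_tm:
  "tm_init peel_tm w =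
    (SETUP, [(fst (input_tape w), int 0), (arr 0 (\<lambda>_. 2), int 0), (arr 0 (\<lambda>_. 1), int 0), (\<lambda>_. 0, 0),
             (arr 0 (\<lambda>_. 2), int 0)])"
  by (simp add: tm_init_def peel_tm_def blank_tape_def input_tape_def arr_def numeral_eq_Suc fun_eq_iff)

lemma run_init:
  "reach (tm_init peel_tm (unary n @ ws)) (2 * n + 2) (round_config n ws {..<n} (int n))"
proof -
  let ?I = "fst (input_tape (unary n @ ws))"
  let ?C = "(arr n (\<lambda>_. 2), int n)"
  let ?C' = "(arr (Suc n) (\<lambda>_. 2), int n)"
  have I: "reads ?I (int 0) (replicate n True)" "?I (int n) = 1"
    using reads_input_tape[of "unary n @ ws"] by (simp_all add: reads_unary)
  have "arr n (\<lambda>_. 2) = arr n (mark {..<n})" "arr n (\<lambda>_. 1) = arr n (tally (\<lambda>_. 0))"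
    by (auto intro: arr_cong simp: mark_def tally_def)
  note arr_eq = this
  have "reach (tm_init peel_tm (unary n @ ws)) n
      (SETUP, [(?I, int n), (arr n (\<lambda>_. 2), int n), (arr n (\<lambda>_. 1), int n), (\<lambda>_. 0, 0), ?C])"
    using run_setup[OF I(1), of "\<lambda>_. 0" 0] by (simp only: tm_init_peel_tm add_0)
  moreover have "tm_step peel_tm
      (SETUP, [(?I, int n), (arr n (\<lambda>_. 2), int n), (arr n (\<lambda>_. 1), int n), (\<lambda>_. 0, 0), ?C]) =
      (RETURN, [(marked_input n ws, int n), (arr n (\<lambda>_. 2), int n - 1), (arr n (\<lambda>_. 1), int n - 1),
                (origin, 0), ?C'])"
    using I(2) by (auto simp: step_simps marked_input_def arr_extend origin_def fun_eq_iff)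
  moreover have "reach
      (RETURN, [(marked_input n ws, int n), (arr n (\<lambda>_. 2), int n - 1), (arr n (\<lambda>_. 1), int n - 1),
                (origin, 0), ?C']) (Suc n) (round_config n ws {..<n} (int n))"
    unfolding arr_eq round_config_def by (rule run_return) simp
  ultimately have "reach (tm_init peel_tm (unary n @ ws)) (n + Suc (Suc n)) (round_config n ws {..<n} (int n))"
    by (intro reach_trans[OF _ reach_step_trans])
  thus ?thesis by (rule reach_mono) simp
qed

lemma seek_step:
  assumes "k < Suc n"
  shows "tm_step peel_tm (round_config n ws S (int k)) =
    (TAIL, [(marked_input n ws, int n + 1), (arr n (mark S), 0), (arr n (tally (\<lambda>_. 0)), 0),
            (origin, 0), (arr (Suc n) (\<lambda>_. 2), int k - 1)])"
  using assms marked_input_marker[of n ws "int n"] by (simp add: round_config_def step_simps arr_int)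

lemma run_round:
  assumes "\<forall>e \<in> set es. proper_arc n e" "k < Suc n"
  shows "reach (round_config n (encode es) S (int k)) (4 * length (encode es) + 2 * n + 5)
    (round_config n (encode es) (prune n es S) (int k - 1))"
proof -
  let ?W = "marked_input n (encode es)" and ?m = "length (encode es)"
  let ?C = "(arr (Suc n) (\<lambda>_. 2), int k - 1)" and ?A = "arr n (mark S)"
  let ?B = "arr n (tally (outs es S))" and ?Z = "arr n (tally (\<lambda>_. 0))"
  let ?A' = "arr n (mark (prune n es S))"
  let ?i = "int n + 1 + int ?m"
  have "reach (TAIL, [(?W, int n + 1), (?A, 0), (?Z, 0), (origin, 0), ?C]) (3 * ?m)
      (TAIL, [(?W, ?i), (?A, 0), (?B, 0), (origin, 0), ?C])"
    using run_arcs[OF assms(1) reads_marked_input, where S = S and h = "\<lambda>_. 0" and C = ?C] by simp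
  moreover have "tm_step peel_tm (TAIL, [(?W, ?i), (?A, 0), (?B, 0), (origin, 0), ?C]) =
      (UPDATE, [(?W, ?i), (?A, 0), (?B, 0), (origin, 0), ?C])"
    using marked_input_end[of n "encode es"] by (simp add: step_simps origin_def)
  moreover have "reach (UPDATE, [(?W, ?i), (?A, 0), (?B, 0), (origin, 0), ?C]) n
      (UPDATE, [(?W, ?i), (?A', int n), (?Z, int n), (origin, 0), ?C])"
  proof -
    have "arr n (mark ({v. v < n \<and> 2 \<le> outs es S v} \<union> (S - {..<n}))) = ?A'"
      "arr n (tally (\<lambda>v. if v < n then 0 else outs es S v)) = ?Z"
      by (auto intro!: arr_cong simp: mark_def tally_def prune_def)
    thus ?thesis
      using run_update[of n n "(?W, ?i)" S "outs es S"] by simp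
  qed
  moreover have "tm_step peel_tm (UPDATE, [(?W, ?i), (?A', int n), (?Z, int n), (origin, 0), ?C]) =
      (RETURN, [(?W, ?i), (?A', int n - 1), (?Z, int n - 1), (origin, 0), ?C])"
    by (simp add: step_simps arr_int)
  moreover have "reach (RETURN, [(?W, ?i), (?A', int n - 1), (?Z, int n - 1), (origin, 0), ?C]) (Suc n)
      (SEEK, [(?W, ?i), (?A', 0), (?Z, 0), (origin, 0), ?C])"
    by (rule run_return) simp
  moreover have "reach (SEEK, [(?W, ?i), (?A', 0), (?Z, 0), (origin, 0), ?C]) (Suc ?m)
      (round_config n (encode es) (prune n es S) (int k - 1))"
    using run_seek[of "Suc ?m" ?W "int n"]
    by (simp add: round_config_def marked_input_marker add.assoc)
  ultimately have "reach (round_config n (encode es) S (int k))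
      (Suc (3 * ?m + Suc (n + Suc (Suc n + Suc ?m)))) (round_config n (encode es) (prune n es S) (int k - 1))"
    by (intro reach_step_trans[OF seek_step[OF assms(2)]]
        reach_trans[OF _ reach_step_trans[OF _ reach_trans[OF _ reach_step_trans[OF _ reach_trans]]]])
  thus ?thesis by (rule reach_mono) simp
qed

lemma run_rounds:
  assumes "\<forall>e \<in> set es. proper_arc n e" "k \<le> Suc n"
  shows "reach (round_config n (encode es) S (int k - 1)) (k * (4 * length (encode es) + 2 * n + 5))
    (round_config n (encode es) ((prune n es ^^ k) S) (-1))"
  using assms(2)
proof (induction k arbitrary: S)
  case 0
  show ?case by (simp add: reach_refl)
next
  case (Suc k)
  have "reach (round_config n (encode es) S (int k)) (4 * length (encode es) + 2 * n + 5)
    (round_config n (encode es) (prune n es S) (int k - 1))"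
    using run_round[OF assms(1)] Suc.prems by simp
  from reach_trans[OF this Suc.IH] Suc.prems show ?case
    by (simp only: funpow_Suc_right comp_apply mult_Suc) simp
qed

lemma run_end:
  assumes "S \<subseteq> {..<n}"
  shows "\<exists>c. reach (round_config n ws S (-1)) (n + 2) c \<and> fst c = (if S = {} then ACCEPT else REJECT)"
proof -
  \<comment> \<open>The head of \<open>A\<close> stops at the first present vertex, or behind the last vertex.\<close>
  define m where "m = (LEAST j. j = n \<or> j \<in> S)"
  have m: "m = n \<or> m \<in> S" "m \<le> n" "\<And>j. j < m \<Longrightarrow> j \<notin> S"
    unfolding m_def by (rule LeastI2[of _ n]; simp) (auto intro: Least_le dest: not_less_Least)
  let ?c = "\<lambda>m. (FINAL, [(marked_input n ws, int n), (arr n (mark S), int m),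
    (arr n (tally (\<lambda>_. 0)), 0), (origin, 0), (arr (Suc n) (\<lambda>_. 2), -1)])"
  have "tm_step peel_tm (round_config n ws S (-1)) = ?c 0"
    using marked_input_marker[of n ws "int n"] by (simp add: round_config_def step_simps arr_neg)
  moreover have "reach (?c 0) m (?c m)"
    using run_final[OF m(2,3)] by simp
  ultimately have "reach (round_config n ws S (-1)) (Suc (m + 1)) (tm_step peel_tm (?c m))"
    by (intro reach_step_trans[OF _ reach_trans[OF _ reach_step]])
  hence "reach (round_config n ws S (-1)) (n + 2) (tm_step peel_tm (?c m))"
    by (rule reach_mono) (use m(2) in simp)
  moreover have "fst (tm_step peel_tm (?c m)) = (if S = {} then ACCEPT else REJECT)"
  proof (cases "S = {}")
    case True
    hence "m = n" using m(1) by simp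
    thus ?thesis using True by (simp add: step_simps arr_int)
  next
    case False
    then obtain j where "j \<in> S" by blast
    hence "m \<in> S" using m(1,3) assms by auto
    hence "m < n" using assms by auto
    thus ?thesis using \<open>m \<in> S\<close> by (auto simp: step_simps arr_int mark_def)
  qed
  ultimately show ?thesis by blast
qed

lemma peel_tm_proper:
  assumes "\<forall>e \<in> set es. proper_arc n e"
  shows "\<exists>c. reach (tm_init peel_tm (digraph_code n es))
      (2 * n + 2 + (Suc n * (4 * length (encode es) + 2 * n + 5) + (n + 2))) c \<and>
    fst c = (if (prune n es ^^ Suc n) {..<n} = {} then ACCEPT else REJECT)"
proof -
  have "(prune n es ^^ Suc n) {..<n} \<subseteq> {..<n}"
    by (auto simp: prune_def)
  then obtain c where c:
    "reach (round_config n (encode es) ((prune n es ^^ Suc n) {..<n}) (-1)) (n + 2) c"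
    "fst c = (if (prune n es ^^ Suc n) {..<n} = {} then ACCEPT else REJECT)"
    using run_end by blast
  have n: "int (Suc n) - 1 = int n" by simp
  show ?thesis
    using reach_trans[OF run_init reach_trans[OF run_rounds[OF assms le_refl, unfolded n] c(1)]] c(2)
    unfolding digraph_code_encode by blast
qed

lemma peel_tm_improper:
  assumes "\<And>es. \<forall>e \<in> set es. proper_arc n e \<Longrightarrow> ws \<noteq> encode es"
  shows "rejects (tm_init peel_tm (unary n @ ws)) (2 * n + 2 + Suc (3 * length ws + 3))"
proof (rule rejects_trans[OF run_init rejects_step_trans[OF seek_step]])
  show "rejects (TAIL, [(marked_input n ws, int n + 1), (arr n (mark {..<n}), 0),
      (arr n (tally (\<lambda>_. 0)), 0), (origin, 0), (arr (Suc n) (\<lambda>_. 2), int n - 1)]) (3 * length ws + 3)"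
    using assms by (rule rejects_improper) (simp_all add: reads_marked_input marked_input_end)
qed simp

lemma peel_tm_no_header: "rejects (tm_init peel_tm (replicate k True)) (k + 1)"
proof -
  let ?w = "replicate k True"
  let ?I = "fst (input_tape ?w)"
  have "reads ?I (int 0) ?w" using reads_input_tape[of ?w] by simp
  from run_setup[OF this, of "\<lambda>_. 0" 0]
  have "reach (tm_init peel_tm ?w) k
      (SETUP, [(?I, int k), (arr k (\<lambda>_. 2), int k), (arr k (\<lambda>_. 1), int k), (\<lambda>_. 0, 0),
               (arr k (\<lambda>_. 2), int k)])"
    by (simp only: tm_init_peel_tm add_0)
  thus ?thesis
    by (rule rejects_trans) (intro rejects_step, simp add: step_simps input_tape_def)
qed

section \<open>Correctness and running time\<close>

lemma digraph_code_in_language_iff: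
  "digraph_code n es \<in> branching_acyclic_partition_language \<longleftrightarrow>
    (\<forall>e \<in> set es. proper_arc n e) \<and> (prune n es ^^ Suc n) {..<n} = {}"
proof -
  have "digraph_code n es \<in> branching_acyclic_partition_language \<longleftrightarrow>
      (fin_digraph (list_digraph n es) \<and> loopfree_digraph (list_digraph n es)) \<and>
      has_branching_acyclic_partition (list_digraph n es)"
    unfolding branching_acyclic_partition_language_def mem_Collect_eq digraph_code_inject by blast
  thus ?thesis
    unfolding list_digraph_proper_iff using has_partition_list_digraph_iff by blast
qed

lemma funpow_fixed: "f x = x \<Longrightarrow> (f ^^ k) x = x"
  by (induction k) simp_all

lemma reach_halted:
  assumes "reach c s c'" "fst c' = ACCEPT \<or> fst c' = REJECT" "s \<le> t"
  shows "(tm_step peel_tm ^^ t) c = c'"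
proof -
  obtain k where k: "k \<le> s" "(tm_step peel_tm ^^ k) c = c'"
    using assms(1) by (auto simp: reach_def)
  have "tm_step peel_tm c' = c'"
    using assms(2) by (auto simp: tm_step_def peel_tm_def)
  hence "(tm_step peel_tm ^^ (t - k)) c' = c'"
    by (rule funpow_fixed)
  thus ?thesis
    using k assms(3) funpow_add[of "t - k" k "tm_step peel_tm"] by simp
qed

lemma peel_tm_decides:
  "\<exists>c. reach (tm_init peel_tm w) (10 + 10 * length w + 10 * (length w)\<^sup>2) c \<and>
    fst c = (if w \<in> branching_acyclic_partition_language then ACCEPT else REJECT)"
proof -
  let ?t = "10 + 10 * length w + 10 * (length w)\<^sup>2"
  have reject: ?thesis if rej: "rejects (tm_init peel_tm w) s" and le: "s \<le> 10 + 10 * length w"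
    and notin: "w \<notin> branching_acyclic_partition_language" for s
  proof -
    obtain c where "reach (tm_init peel_tm w) s c" "fst c = REJECT"
      using rej unfolding rejects_def by blast
    thus ?thesis
      using reach_mono[OF _ trans_le_add1[OF le]] notin by (intro exI[of _ c]) simp
  qed
  show ?thesis
  proof (cases w rule: bool_list_cases)
    case (ones k)
    hence "False \<notin> set w" by simp
    moreover have "False \<in> set (digraph_code n es)" for n es
      by (simp add: digraph_code_def unary_def)
    ultimately have "w \<notin> branching_acyclic_partition_language"
      by (auto simp: branching_acyclic_partition_language_def)
    moreover have "rejects (tm_init peel_tm w) (k + 1)"
      using peel_tm_no_header ones by simp
    moreover have "k + 1 \<le> 10 + 10 * length w"
      unfolding ones length_replicate by linarith
    ultimately show ?thesis
      using reject by blast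
  next
    case (block n ws)
    show ?thesis
    proof (cases "\<exists>es. (\<forall>e \<in> set es. proper_arc n e) \<and> ws = encode es")
      case True
      then obtain es where es: "\<forall>e \<in> set es. proper_arc n e" "ws = encode es" by blast
      have w: "w = digraph_code n es"
        using block es(2) by (simp add: digraph_code_encode)
      let ?m = "length (encode es)"
      have len: "length w = n + 1 + ?m"
        using block es(2) by simp
      have "Suc n * (4 * ?m + 2 * n + 5) \<le> length w * (5 * length w)"
        by (rule mult_mono) (simp_all add: len)
      also have "\<dots> = 5 * (length w)\<^sup>2"
        by (simp add: power2_eq_square)
      finally have le: "2 * n + 2 + (Suc n * (4 * ?m + 2 * n + 5) + (n + 2)) \<le> ?t"
        using len by linarith
      obtain c where c: "reach (tm_init peel_tm w)
          (2 * n + 2 + (Suc n * (4 * ?m + 2 * n + 5) + (n + 2))) c"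
        "fst c = (if (prune n es ^^ Suc n) {..<n} = {} then ACCEPT else REJECT)"
        unfolding w using peel_tm_proper[OF es(1)] by blast
      have "w \<in> branching_acyclic_partition_language \<longleftrightarrow> (prune n es ^^ Suc n) {..<n} = {}"
        unfolding w digraph_code_in_language_iff using es(1) by blast
      hence "fst c = (if w \<in> branching_acyclic_partition_language then ACCEPT else REJECT)"
        by (simp only: c(2))
      thus ?thesis
        using reach_mono[OF c(1) le] by blast
    next
      case False
      have "w \<notin> branching_acyclic_partition_language"
      proof
        assume "w \<in> branching_acyclic_partition_language"
        then obtain m es where "w = digraph_code m es" "\<forall>e \<in> set es. proper_arc m e"
          unfolding branching_acyclic_partition_language_def mem_Collect_eq
          using list_digraph_proper_iff by blast
        thus False
          using False block by (auto simp: digraph_code_encode unary_append_inject)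
      qed
      moreover have "rejects (tm_init peel_tm w) (2 * n + 2 + Suc (3 * length ws + 3))"
        unfolding block using False by (intro peel_tm_improper) blast
      moreover have "2 * n + 2 + Suc (3 * length ws + 3) \<le> 10 + 10 * length w"
        unfolding block length_append length_unary by presburger
      ultimately show ?thesis
        using reject by blast
    qed
  qed
qed

lemma poly_time_decidable_language: "poly_time_decidable branching_acyclic_partition_language"
  unfolding poly_time_decidable_def
proof (intro exI conjI allI)
  show "tm_wf peel_tm" by (rule tm_wf_peel_tm)
  fix w
  let ?p = "[:10, 10, 10:] :: nat poly"
  obtain c where c: "reach (tm_init peel_tm w) (10 + 10 * length w + 10 * (length w)\<^sup>2) c"
    "fst c = (if w \<in> branching_acyclic_partition_language then ACCEPT else REJECT)"
    using peel_tm_decides by blast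
  have p: "poly ?p (length w) = 10 + 10 * length w + 10 * (length w)\<^sup>2"
    by (simp add: power2_eq_square algebra_simps)
  have "(tm_step peel_tm ^^ poly ?p (length w)) (tm_init peel_tm w) = c"
    unfolding p using c(2) by (intro reach_halted[OF c(1)]) simp_all
  moreover have "tm_accept peel_tm = ACCEPT" "tm_reject peel_tm = REJECT"
    by (simp_all add: peel_tm_def)
  ultimately show "fst ((tm_step peel_tm ^^ poly ?p (length w)) (tm_init peel_tm w)) =
      (if w \<in> branching_acyclic_partition_language then tm_accept peel_tm else tm_reject peel_tm)"
    using c(2) by (simp only:)
qed

theorem theorem3p1:
  shows "poly_time_decidable branching_acyclic_partition_language \<and>
    (\<forall>D :: ('a, 'b) pre_digraph. fin_digraph D \<and> loopfree_digraph D \<longrightarrow>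
       (has_branching_acyclic_partition D \<longleftrightarrow>
        \<not> (\<exists>H. induced_subgraph H D \<and> verts H \<noteq> {} \<and> (\<forall>v \<in> verts H. 2 \<le> out_degree H v))))"
proof (intro conjI allI impI)
  show "poly_time_decidable branching_acyclic_partition_language"
    by (rule poly_time_decidable_language)
  fix D :: "('a, 'b) pre_digraph"
  assume "fin_digraph D \<and> loopfree_digraph D"
  thus "has_branching_acyclic_partition D \<longleftrightarrow>
      \<not> (\<exists>H. induced_subgraph H D \<and> verts H \<noteq> {} \<and> (\<forall>v \<in> verts H. 2 \<le> out_degree H v))"
    using branching_acyclic_partition_iff[of D]
      ex_induced_subgraph_iff_two_out_closed[OF fin_digraph.axioms(1), of D] by simp
qed

end
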